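(* Let $G=(V,E,W)$ and $\widetilde G=(\widetilde V,\widetilde E,\widetilde W)$ be weighted, connected graphs with $|V|=|\widetilde V|=n$, let $\lambda_1^*=\max\{\lambda_1,\widetilde\lambda_1\}$, and let $\mathbf{M}=\mathbf{I}$ so that $\mathbf{K}=\mathbf{T}$. Let $\mathcal{W}^{(2)}_J$ be the wavelets constructed from $\mathbf{T}$ and let $\widetilde{\mathcal{W}}^{(2)}_J$ be the corresponding wavelets on $\widetilde G$ constructed from $\widetilde{\mathbf{T}}$. Then there exists a constant $C_{\lambda_1^*}$, depending only on $\lambda_1^*$, such that $$\big\|\mathcal{W}^{(2)}_J-\widetilde{\mathcal{W}}^{(2)}_J\big\|_2^2\le C_{\lambda_1^*}\,\|\mathbf{T}-\widetilde{\mathbf{T}}\|_2 .$$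
   Context: For a weighted, connected (undirected) graph on $\{0,\dots,n-1\}$ with weighted adjacency matrix $\mathbf{A}$, weighted degree vector $\mathbf{d}$ and $\mathbf{D}=\mathrm{diag}(\mathbf{d})$, let $\mathbf{N}=\mathbf{I}-\mathbf{D}^{-1/2}\mathbf{A}\mathbf{D}^{-1/2}$ have eigenvalues $0=\omega_0<\omega_1\le\dots\le\omega_{n-1}\le 2$ and orthonormal eigenbasis $\mathbf{v}_0,\dots,\mathbf{v}_{n-1}$, with $\mathbf{v}_0=\mathbf{d}^{1/2}/\|\mathbf{d}^{1/2}\|_2$, and let $\mathbf{V}$ be the orthogonal matrix with columns $\mathbf{v}_i$. Fix a monotonically decreasing $g:[0,2]\to[0,1]$ with $g(0)=1$, $g(2)=0$; put $\lambda_i=g(\omega_i)$, so $1=\lambda_0>\lambda_1\ge\dots\ge\lambda_{n-1}\ge 0$, $\Lambda=\mathrm{diag}(\lambda_0,\dots,\lambda_{n-1})$ and $\mathbf{T}=\mathbf{V}\Lambda\mathbf{V}^T$. Objects with a tilde are the analogous objects for $\widetilde G$ (with the same $g$). For an integer $J\ge0$ let $p_0(t)=1-t$, $p_j(t)=t^{2^{j-1}}-t^{2^j}$ for $1\le j\le J$, $p_{J+1}(t)=t^{2^J}$. Here (with $\mathbf{M}=\mathbf{I}$) $\mathcal{W}^{(2)}_J=\{p_j(\mathbf{T})\}_{0\le j\le J+1}$ and $\widetilde{\mathcal{W}}^{(2)}_J=\{p_j(\widetilde{\mathbf{T}})\}_{0\le j\le J+1}$. For a family of matrices, $\|\{\mathbf{B}_i\}_i\|_2=\sup_{\|\mathbf{x}\|_2=1}\big(\sum_i\|\mathbf{B}_i\mathbf{x}\|_2^2\big)^{1/2}$,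 and differences of families are taken elementwise; for a single matrix $\|\cdot\|_2$ is the Euclidean operator norm. *)

theory Defs
  imports
    Complex_Main
    "Graph_Theory.Graph_Theory"
    "Jordan_Normal_Form.Char_Poly"
begin

text \<open>
  Following \<open>Graph_Theory\<close>, an undirected graph is a symmetric digraph: the edge
  \<open>{i, j}\<close> is the pair of arcs \<open>(i, j)\<close>, \<open>(j, i)\<close>. Self-loops are
  permitted. Vertex \<open>i\<close> is the \<open>i\<close>-th coordinate of the vectors and matrices below.
\<close>

definition weighted_connected_graph ::
    "nat \<Rightarrow> nat pair_pre_digraph \<Rightarrow> (nat \<times> nat) weight_fun \<Rightarrow> bool" where
  "weighted_connected_graph n G W \<longleftrightarrow>
     pair_pseudo_graph G \<and> pverts G = {0..<n} \<and> Digraph_Component.connected (with_proj G) \<and>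
     (\<forall>i j. (i, j) \<in> parcs G \<longrightarrow> 0 < W (i, j) \<and> W (i, j) = W (j, i))"

definition adj_mat ::
    "nat \<Rightarrow> nat pair_pre_digraph \<Rightarrow> (nat \<times> nat) weight_fun \<Rightarrow> real mat" where
  "adj_mat n G W = mat n n (\<lambda>(i, j). if (i, j) \<in> parcs G then W (i, j) else 0)"

definition deg_vec ::
    "nat \<Rightarrow> nat pair_pre_digraph \<Rightarrow> (nat \<times> nat) weight_fun \<Rightarrow> real vec" where
  "deg_vec n G W = vec n (\<lambda>i. \<Sum>j<n. adj_mat n G W $$ (i, j))"

definition normalized_laplacian ::
    "nat \<Rightarrow> nat pair_pre_digraph \<Rightarrow> (nat \<times> nat) weight_fun \<Rightarrow> real mat" where
  "normalized_laplacian n G W =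
     (let R = mat_diag n (\<lambda>i. 1 / sqrt (deg_vec n G W $ i))
      in 1\<^sub>m n - R * adj_mat n G W * R)"

definition norm2 :: "real vec \<Rightarrow> real" where
  "norm2 x = sqrt (x \<bullet> x)"

text \<open>
  \<open>\<omega> 0 \<le> \<dots> \<le> \<omega> (n - 1)\<close> and the columns of \<open>V\<close> are the eigenvalues
  and an orthonormal eigenbasis of the normalized Laplacian. That \<open>\<omega> 0 = 0 < \<omega> 1\<close> and
  \<open>\<omega> (n - 1) \<le> 2\<close> is a consequence, not part of the definition.
\<close>

definition laplacian_eigenbasis ::
    "nat \<Rightarrow> nat pair_pre_digraph \<Rightarrow> (nat \<times> nat) weight_fun \<Rightarrow> (nat \<Rightarrow> real) \<Rightarrow> real mat \<Rightarrow> bool"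
where
  "laplacian_eigenbasis n G W \<omega> V \<longleftrightarrow>
     mono_on {..<n} \<omega> \<and>
     V \<in> carrier_mat n n \<and> V\<^sup>T * V = 1\<^sub>m n \<and>
     (\<forall>i<n. eigenvector (normalized_laplacian n G W) (col V i) (\<omega> i)) \<and>
     (let s = map_vec sqrt (deg_vec n G W) in col V 0 = (1 / norm2 s) \<cdot>\<^sub>v s)"

text \<open>
  The condition \<open>g t < 1\<close> for \<open>t > 0\<close> is what makes \<open>\<lambda>\<^sub>1 = g \<omega>\<^sub>1 < 1\<close>;
  it holds for every strictly decreasing \<open>g\<close>, while plateaus below 1 remain allowed.
\<close>

definition spectral_filter :: "(real \<Rightarrow> real) \<Rightarrow> bool" where
  "spectral_filter g \<longleftrightarrow>
     g \<in> {0..2} \<rightarrow> {0..1} \<and> antimono_on {0..2} g \<and> g 0 = 1 \<and> g 2 = 0 \<and>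
     (\<forall>t\<in>{0<..2}. g t < 1)"

definition diffusion_mat ::
    "nat \<Rightarrow> (real \<Rightarrow> real) \<Rightarrow> (nat \<Rightarrow> real) \<Rightarrow> real mat \<Rightarrow> real mat" where
  "diffusion_mat n g \<omega> V = V * mat_diag n (\<lambda>i. g (\<omega> i)) * V\<^sup>T"

text \<open>
  The matrix \<open>p\<^sub>j(T)\<close> for \<open>p\<^sub>0(t) = 1 - t\<close>,
  \<open>p\<^sub>j(t) = t^(2^(j-1)) - t^(2^j)\<close> if \<open>1 \<le> j \<le> J\<close>, and
  \<open>p\<^sub>J\<^sub>+\<^sub>1(t) = t^(2^J)\<close>; only indices \<open>j \<le> J + 1\<close> are meaningful.
\<close>

definition wavelet :: "nat \<Rightarrow> real mat \<Rightarrow> nat \<Rightarrow> real mat" where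
  "wavelet J T j =
     (if j = 0 then 1\<^sub>m (dim_row T) - T
      else if j \<le> J then T ^\<^sub>m (2 ^ (j - 1)) - T ^\<^sub>m (2 ^ j)
      else T ^\<^sub>m (2 ^ J))"

definition opnorm2 :: "nat \<Rightarrow> real mat \<Rightarrow> real" where
  "opnorm2 n B = (SUP x\<in>{x \<in> carrier_vec n. norm2 x = 1}. norm2 (B *\<^sub>v x))"

definition family_norm2 :: "nat \<Rightarrow> 'i set \<Rightarrow> ('i \<Rightarrow> real mat) \<Rightarrow> real" where
  "family_norm2 n I B =
     (SUP x\<in>{x \<in> carrier_vec n. norm2 x = 1}. sqrt (\<Sum>i\<in>I. (norm2 (B i *\<^sub>v x))\<^sup>2))"

end

theory Submission
  imports Defs "HOL-Analysis.L2_Norm"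
begin

text \<open>
  Write \<open>T = P + R\<close> with \<open>P\<close> the projection onto \<open>v\<^sub>0\<close>, so that \<open>\<parallel>R\<parallel> \<le> l < 1\<close> and
  \<open>T\<^sup>k = P + R\<^sup>k\<close> for \<open>k \<ge> 1\<close>. With \<open>\<delta> = \<parallel>T - T'\<parallel>\<close>, the spectral gap gives
  \<open>\<parallel>P - P'\<parallel> \<le> 2 \<delta> / (1 - l)\<close>, hence \<open>\<parallel>R - R'\<parallel> \<le> \<kappa>\<close> with \<open>\<kappa> = \<delta> + 2 \<delta> / (1 - l)\<close>,
  and telescoping gives \<open>\<parallel>R\<^sup>k - R'\<^sup>k\<parallel> \<le> k l\<^sup>k\<^sup>-\<^sup>1 \<kappa>\<close>. The projections cancel in the band-pass
  wavelets, and \<open>\<Sum>\<^sub>k k l\<^sup>k\<^sup>-\<^sup>1 = 1 / (1 - l)\<^sup>2\<close> bounds the sum of the norms over all scales by a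
  multiple of \<open>\<delta>\<close> that does not depend on \<open>J\<close>. Finally \<open>\<delta>\<^sup>2 \<le> 2 \<delta>\<close>.
\<close>

section \<open>Euclidean norm and operator bounds\<close>

lemma norm2_L2_set: "norm2 x = L2_set (($) x) {..<dim_vec x}"
  by (simp add: norm2_def L2_set_def scalar_prod_def power2_eq_square atLeast0LessThan)

lemma norm2_nonneg [simp]: "0 \<le> norm2 x"
  by (simp add: norm2_L2_set)

lemma norm2_power2: "(norm2 x)\<^sup>2 = x \<bullet> x"
proof -
  have "0 \<le> x \<bullet> x"
    by (auto simp: scalar_prod_def intro!: sum_nonneg)
  then show ?thesis by (simp add: norm2_def)
qed

lemma norm2_add_le:
  assumes "x \<in> carrier_vec n" "y \<in> carrier_vec n"
  shows "norm2 (x + y) \<le> norm2 x + norm2 y"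
proof -
  have "norm2 (x + y) = L2_set (\<lambda>i. x $ i + y $ i) {..<n}"
    using assms by (auto simp: norm2_L2_set intro!: L2_set_cong)
  then show ?thesis
    using assms L2_set_triangle_ineq[of "($) x" "($) y" "{..<n}"] by (simp add: norm2_L2_set)
qed

lemma norm2_uminus: "norm2 (- x) = norm2 x"
  by (simp add: norm2_def)

lemma scalar_prod_le_norm2:
  assumes "x \<in> carrier_vec n" "y \<in> carrier_vec n"
  shows "x \<bullet> y \<le> norm2 x * norm2 y"
proof -
  have "x \<bullet> y \<le> (\<Sum>i<n. \<bar>x $ i\<bar> * \<bar>y $ i\<bar>)"
    using assms by (auto simp: scalar_prod_def atLeast0LessThan abs_mult[symmetric] intro!: sum_mono)
  also have "\<dots> \<le> norm2 x * norm2 y"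
    using assms L2_set_mult_ineq[of "($) x" "($) y" "{..<n}"] by (simp add: norm2_L2_set)
  finally show ?thesis .
qed

text \<open>An explicit constant stands in for the supremum \<open>opnorm2\<close>, so that norm
  estimates compose by introduction rules.\<close>

definition op_bounded :: "nat \<Rightarrow> real \<Rightarrow> real mat \<Rightarrow> bool" where
  "op_bounded n c A \<longleftrightarrow>
     A \<in> carrier_mat n n \<and> 0 \<le> c \<and> (\<forall>x\<in>carrier_vec n. norm2 (A *\<^sub>v x) \<le> c * norm2 x)"

lemma op_bounded_one: "op_bounded n 1 (1\<^sub>m n)"
  by (auto simp: op_bounded_def)

lemma op_bounded_add:
  assumes "op_bounded n a A" "op_bounded n b B"
  shows "op_bounded n (a + b) (A + B)"
  unfolding op_bounded_def
proof (intro conjI ballI)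
  fix x :: "real vec" assume x: "x \<in> carrier_vec n"
  have AB: "A \<in> carrier_mat n n" "B \<in> carrier_mat n n"
    using assms by (auto simp: op_bounded_def)
  have "norm2 ((A + B) *\<^sub>v x) = norm2 (A *\<^sub>v x + B *\<^sub>v x)"
    using add_mult_distrib_mat_vec[OF AB x] by simp
  also have "\<dots> \<le> norm2 (A *\<^sub>v x) + norm2 (B *\<^sub>v x)"
    by (rule norm2_add_le[of _ n]) (use AB x in auto)
  also have "\<dots> \<le> a * norm2 x + b * norm2 x"
    using assms x by (intro add_mono) (auto simp: op_bounded_def)
  finally show "norm2 ((A + B) *\<^sub>v x) \<le> (a + b) * norm2 x" by (simp add: algebra_simps)
qed (use assms in \<open>auto simp: op_bounded_def\<close>)

lemma op_bounded_uminus: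
  assumes "op_bounded n a A"
  shows "op_bounded n a (- A)"
  using assms by (auto simp: op_bounded_def norm2_uminus)

lemma op_bounded_diff:
  assumes "op_bounded n a A" "op_bounded n b B"
  shows "op_bounded n (a + b) (A - B)"
proof -
  have "A - B = A + (- B)"
    using assms by (intro eq_matI) (auto simp: op_bounded_def)
  then show ?thesis
    using op_bounded_add[OF assms(1) op_bounded_uminus[OF assms(2)]] by simp
qed

lemma op_bounded_mult:
  assumes "op_bounded n a A" "op_bounded n b B"
  shows "op_bounded n (a * b) (A * B)"
  unfolding op_bounded_def
proof (intro conjI ballI)
  fix x :: "real vec" assume x: "x \<in> carrier_vec n"
  have AB: "A \<in> carrier_mat n n" "B \<in> carrier_mat n n"
    using assms by (auto simp: op_bounded_def)
  have "norm2 ((A * B) *\<^sub>v x) = norm2 (A *\<^sub>v (B *\<^sub>v x))"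
    using assoc_mult_mat_vec[OF AB x] by simp
  also have "\<dots> \<le> a * norm2 (B *\<^sub>v x)"
    using assms(1) AB x by (auto simp: op_bounded_def)
  also have "\<dots> \<le> a * (b * norm2 x)"
    using assms x by (intro mult_left_mono) (auto simp: op_bounded_def)
  finally show "norm2 ((A * B) *\<^sub>v x) \<le> a * b * norm2 x" by (simp add: algebra_simps)
qed (use assms in \<open>auto simp: op_bounded_def\<close>)

lemma op_bounded_pow:
  assumes "op_bounded n a A"
  shows "op_bounded n (a ^ k) (A ^\<^sub>m k)"
proof (induction k)
  case 0
  have "dim_row A = n" using assms by (auto simp: op_bounded_def)
  then show ?case by (simp add: op_bounded_one)
next
  case (Suc k)
  then show ?case using op_bounded_mult[OF Suc assms] by (simp add: mult.commute)
qed

text \<open>With y = A^T x one has |y|^2 = <x, A y> <= |x| a |y|; cancel one factor |y|.\<close>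

lemma op_bounded_transpose:
  assumes "op_bounded n a A"
  shows "op_bounded n a (A\<^sup>T)"
  unfolding op_bounded_def
proof (intro conjI ballI)
  fix x :: "real vec" assume x: "x \<in> carrier_vec n"
  have A: "A \<in> carrier_mat n n" and a: "0 \<le> a"
    using assms by (auto simp: op_bounded_def)
  define y where "y = A\<^sup>T *\<^sub>v x"
  have y: "y \<in> carrier_vec n" using A x by (auto simp: y_def)
  have "(norm2 y)\<^sup>2 = x \<bullet> (A *\<^sub>v y)"
    unfolding norm2_power2 using transpose_vec_mult_scalar[OF A y x] by (simp add: y_def)
  also have "\<dots> \<le> norm2 x * norm2 (A *\<^sub>v y)"
    by (rule scalar_prod_le_norm2[of _ n]) (use A x y in auto)
  also have "\<dots> \<le> norm2 x * (a * norm2 y)"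
    using assms y by (intro mult_left_mono) (auto simp: op_bounded_def)
  finally have *: "norm2 y * norm2 y \<le> (a * norm2 x) * norm2 y"
    by (simp add: power2_eq_square algebra_simps)
  show "norm2 (A\<^sup>T *\<^sub>v x) \<le> a * norm2 x"
  proof (cases "norm2 y = 0")
    case True
    then show ?thesis using a by (simp add: y_def[symmetric])
  next
    case False
    then have "0 < norm2 y" using norm2_nonneg[of y] by linarith
    then show ?thesis using * by (simp add: y_def[symmetric])
  qed
qed (use assms in \<open>auto simp: op_bounded_def\<close>)

lemma op_bounded_isometry:
  assumes "A \<in> carrier_mat n n" "A\<^sup>T * A = 1\<^sub>m n"
  shows "op_bounded n 1 A"
proof -
  have "norm2 (A *\<^sub>v x) = norm2 x" if x: "x \<in> carrier_vec n" for x
  proof -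
    have "(A *\<^sub>v x) \<bullet> (A *\<^sub>v x) = (A\<^sup>T *\<^sub>v (A *\<^sub>v x)) \<bullet> x"
      using transpose_vec_mult_scalar[of A n n x "A *\<^sub>v x"] assms x by auto
    also have "A\<^sup>T *\<^sub>v (A *\<^sub>v x) = x"
      using assoc_mult_mat_vec[of "A\<^sup>T" n n A n x] assms x by auto
    finally show ?thesis by (simp add: norm2_def)
  qed
  then show ?thesis using assms by (auto simp: op_bounded_def)
qed

text \<open>Telescoping: A^(m+1) - B^(m+1) = A^m (A - B) + (A^m - B^m) B, where both matrices share
  the bound \<open>a\<close>. Writing the exponent as \<open>Suc k\<close> avoids truncated
  subtraction in the bound.\<close>

lemma op_bounded_pow_diff:
  assumes A: "op_bounded n a A" and B: "op_bounded n a B" and D: "op_bounded n d (A - B)"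
  shows "op_bounded n (d * (real (Suc k) * a ^ k)) (A ^\<^sub>m Suc k - B ^\<^sub>m Suc k)"
proof (induction k)
  case 0
  have "A \<in> carrier_mat n n" "B \<in> carrier_mat n n"
    using A B by (auto simp: op_bounded_def)
  then show ?case using D by simp
next
  case (Suc k)
  let ?m = "Suc k"
  have c: "A \<in> carrier_mat n n" "B \<in> carrier_mat n n"
    using A B by (auto simp: op_bounded_def)
  then have c': "A ^\<^sub>m ?m \<in> carrier_mat n n" "B ^\<^sub>m ?m \<in> carrier_mat n n"
    by (metis pow_carrier_mat)+
  have "A ^\<^sub>m Suc ?m - B ^\<^sub>m Suc ?m = A ^\<^sub>m ?m * (A - B) + (A ^\<^sub>m ?m - B ^\<^sub>m ?m) * B"
  proof -
    have "A ^\<^sub>m ?m * (A - B) = A ^\<^sub>m ?m * A - A ^\<^sub>m ?m * B"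
      by (rule mult_minus_distrib_mat[OF c'(1) c])
    moreover have "(A ^\<^sub>m ?m - B ^\<^sub>m ?m) * B = A ^\<^sub>m ?m * B - B ^\<^sub>m ?m * B"
      by (rule minus_mult_distrib_mat[OF c' c(2)])
    moreover have "A ^\<^sub>m Suc ?m = A ^\<^sub>m ?m * A" "B ^\<^sub>m Suc ?m = B ^\<^sub>m ?m * B"
      by simp_all
    moreover have "X - Z = (X - Y) + (Y - Z)"
      if "X \<in> carrier_mat n n" "Y \<in> carrier_mat n n" "Z \<in> carrier_mat n n" for X Y Z :: "real mat"
      using that by (intro eq_matI) auto
    ultimately show ?thesis
      using c c' by (metis mult_carrier_mat)
  qed
  moreover have "op_bounded n (a ^ ?m * d + d * (real ?m * a ^ k) * a)
      (A ^\<^sub>m ?m * (A - B) + (A ^\<^sub>m ?m - B ^\<^sub>m ?m) * B)"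
    by (intro op_bounded_add op_bounded_mult op_bounded_pow A B D Suc)
  moreover have "a ^ ?m * d + d * (real ?m * a ^ k) * a = d * (real (Suc ?m) * a ^ ?m)"
    by (simp add: algebra_simps)
  ultimately show ?case by metis
qed

section \<open>Operator and family norms as suprema over the unit sphere\<close>

lemma unit_vec_unit_sphere: "0 < n \<Longrightarrow> unit_vec n 0 \<in> {x \<in> carrier_vec n. norm2 x = 1}"
  by (auto simp: norm2_def)

text \<open>The a priori bound \<open>a\<close> makes the real supremum meaningful and
  \<open>0 < n\<close> makes the sphere nonempty; rescaling extends the bound to all
  vectors.\<close>

lemma op_bounded_opnorm2:
  assumes n: "0 < n" and A: "op_bounded n a A"
  shows "op_bounded n (opnorm2 n A) A" and "opnorm2 n A \<le> a"
proof -
  let ?S = "{x \<in> carrier_vec n. norm2 x = 1}"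
  have le: "norm2 (A *\<^sub>v x) \<le> a" if "x \<in> ?S" for x
    using A that by (auto simp: op_bounded_def)
  have bdd: "bdd_above ((\<lambda>x. norm2 (A *\<^sub>v x)) ` ?S)"
    using le by (intro bdd_aboveI2[of _ _ a]) auto
  show "opnorm2 n A \<le> a"
    unfolding opnorm2_def using unit_vec_unit_sphere[OF n] le by (intro cSUP_least) blast+
  have up: "norm2 (A *\<^sub>v x) \<le> opnorm2 n A" if "x \<in> ?S" for x
    unfolding opnorm2_def using that bdd by (rule cSUP_upper)
  have c: "A \<in> carrier_mat n n" using A by (simp add: op_bounded_def)
  show "op_bounded n (opnorm2 n A) A"
    unfolding op_bounded_def
  proof (intro conjI ballI c)
    show "0 \<le> opnorm2 n A"
      using up[OF unit_vec_unit_sphere[OF n]] norm2_nonneg order_trans by blast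
    fix x :: "real vec" assume x: "x \<in> carrier_vec n"
    show "norm2 (A *\<^sub>v x) \<le> opnorm2 n A * norm2 x"
    proof (cases "norm2 x = 0")
      case True
      moreover have "norm2 (A *\<^sub>v x) \<le> a * norm2 x" using A x by (simp add: op_bounded_def)
      ultimately show ?thesis by simp
    next
      case False
      then have pos: "0 < norm2 x" using norm2_nonneg[of x] by linarith
      define u where "u = (1 / norm2 x) \<cdot>\<^sub>v x"
      have scale: "norm2 (t \<cdot>\<^sub>v y) = t * norm2 y" if "0 \<le> t" for t y
        using that by (simp add: norm2_def real_sqrt_mult)
      have "u \<in> ?S"
        using x pos by (simp add: u_def scale)
      then have "norm2 (A *\<^sub>v u) \<le> opnorm2 n A" by (rule up)
      moreover have "A *\<^sub>v u = (1 / norm2 x) \<cdot>\<^sub>v (A *\<^sub>v x)"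
        using mult_mat_vec[OF c x] by (simp add: u_def)
      ultimately show ?thesis
        using pos by (simp add: scale field_simps)
    qed
  qed
qed

text \<open>The Euclidean norm of a tuple is at most the sum of its entries. This is crude, but
  enough because the wavelet bounds are summable over the scales.\<close>

lemma family_norm2_le_sum:
  assumes n: "0 < n" and B: "\<And>i. i \<in> I \<Longrightarrow> op_bounded n (c i) (B i)"
  shows "0 \<le> family_norm2 n I B" and "family_norm2 n I B \<le> sum c I"
proof -
  let ?S = "{x \<in> carrier_vec n. norm2 x = 1}"
  have le: "sqrt (\<Sum>i\<in>I. (norm2 (B i *\<^sub>v x))\<^sup>2) \<le> sum c I" if x: "x \<in> ?S" for x
  proof -
    have "sqrt (\<Sum>i\<in>I. (norm2 (B i *\<^sub>v x))\<^sup>2) \<le> (\<Sum>i\<in>I. norm2 (B i *\<^sub>v x))"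
      using L2_set_le_sum[of I "\<lambda>i. norm2 (B i *\<^sub>v x)"] by (simp add: L2_set_def)
    also have "\<dots> \<le> sum c I"
      using B x by (intro sum_mono) (force simp: op_bounded_def)
    finally show ?thesis .
  qed
  then have bdd: "bdd_above ((\<lambda>x. sqrt (\<Sum>i\<in>I. (norm2 (B i *\<^sub>v x))\<^sup>2)) ` ?S)"
    by (intro bdd_aboveI2[of _ _ "sum c I"]) auto
  show "family_norm2 n I B \<le> sum c I"
    unfolding family_norm2_def using unit_vec_unit_sphere[OF n] le by (intro cSUP_least) blast+
  show "0 \<le> family_norm2 n I B"
    unfolding family_norm2_def
    by (rule cSUP_upper2[OF bdd unit_vec_unit_sphere[OF n]]) (simp add: sum_nonneg)
qed

section \<open>Functional calculus in an orthonormal eigenbasis\<close>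

text \<open>Here \<open>f\<close> acts on the index of an eigenvector, not on its eigenvalue, so
  that spectral projections are instances too and all algebra becomes pointwise.\<close>

definition spectral_mat :: "nat \<Rightarrow> real mat \<Rightarrow> (nat \<Rightarrow> real) \<Rightarrow> real mat" where
  "spectral_mat n V f = V * mat_diag n f * V\<^sup>T"

locale orthogonal_mat =
  fixes n :: nat and V :: "real mat"
  assumes V: "V \<in> carrier_mat n n" and VtV: "V\<^sup>T * V = 1\<^sub>m n"
begin

abbreviation F :: "(nat \<Rightarrow> real) \<Rightarrow> real mat" where
  "F \<equiv> spectral_mat n V"

lemma VVt: "V * V\<^sup>T = 1\<^sub>m n"
  using mat_mult_left_right_inverse[of "V\<^sup>T" n V] V VtV by auto

lemma spectral_carrier [simp]: "F f \<in> carrier_mat n n"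
  using V by (auto simp: spectral_mat_def intro!: mult_carrier_mat[of _ n n])

lemma spectral_dim [simp]: "dim_row (F f) = n" "dim_col (F f) = n"
  using spectral_carrier by blast+

lemma spectral_cong:
  assumes "\<And>i. i < n \<Longrightarrow> f i = h i"
  shows "F f = F h"
proof -
  have "mat_diag n f = mat_diag n h"
    using assms by (auto simp: mat_diag_def intro!: eq_matI)
  then show ?thesis by (simp add: spectral_mat_def)
qed

lemma spectral_one: "F (\<lambda>i. 1) = 1\<^sub>m n"
  using V VVt by (simp add: spectral_mat_def)

lemma spectral_add: "F f + F h = F (\<lambda>i. f i + h i)"
proof -
  have "mat_diag n (\<lambda>i. f i + h i) = mat_diag n f + mat_diag n h"
    by (intro eq_matI) (auto simp: mat_diag_def)
  then show ?thesis
    unfolding spectral_mat_def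
    using V by (simp add: mult_add_distrib_mat[of V n n _ n] add_mult_distrib_mat[of _ n n _ _ n]
        mult_carrier_mat[of _ n n _ n] del: assoc_mult_mat)
qed

lemma spectral_mult: "F f * F h = F (\<lambda>i. f i * h i)"
proof -
  let ?D = "mat_diag n f" and ?E = "mat_diag n h"
  have D: "?D \<in> carrier_mat n n" "?E \<in> carrier_mat n n" by simp_all
  have "F f * F h = V * ?D * (V\<^sup>T * V) * ?E * V\<^sup>T"
    unfolding spectral_mat_def using V D
    by (simp add: assoc_mult_mat[of _ n n _ n _ n] mult_carrier_mat[of _ n n _ n])
  also have "\<dots> = V * (?D * ?E) * V\<^sup>T"
    unfolding VtV using V D by (simp add: assoc_mult_mat[of _ n n _ n _ n] mult_carrier_mat[of _ n n _ n]
        left_mult_one_mat[of _ n n] del: mat_diag_diag)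
  finally show ?thesis by (simp add: spectral_mat_def)
qed

lemma spectral_pow: "F f ^\<^sub>m k = F (\<lambda>i. f i ^ k)"
proof (induction k)
  case 0
  show ?case by (simp add: spectral_one)
next
  case (Suc k)
  then show ?case by (simp add: spectral_mult mult.commute)
qed

lemma spectral_transpose: "(F f)\<^sup>T = F f"
proof -
  have D: "(mat_diag n f)\<^sup>T = mat_diag n f"
    by (intro eq_matI) (auto simp: mat_diag_def)
  have "(F f)\<^sup>T = V * (mat_diag n f)\<^sup>T * V\<^sup>T"
    unfolding spectral_mat_def using V
    by (simp add: transpose_mult[of _ n n _ n] assoc_mult_mat[of _ n n _ n _ n] mult_carrier_mat[of _ n n _ n])
  then show ?thesis by (simp add: D spectral_mat_def)
qed

text \<open>Both \<open>V\<close> and its transpose are isometries, so only the diagonal factor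
  contributes.\<close>

lemma op_bounded_spectral:
  assumes f: "\<And>i. i < n \<Longrightarrow> \<bar>f i\<bar> \<le> c" and c: "0 \<le> c"
  shows "op_bounded n c (F f)"
proof -
  have D: "op_bounded n c (mat_diag n f)"
    unfolding op_bounded_def
  proof (intro conjI ballI c)
    fix x :: "real vec" assume x: "x \<in> carrier_vec n"
    have ix: "(mat_diag n f *\<^sub>v x) $ i = f i * x $ i" if "i < n" for i
    proof -
      have "(mat_diag n f *\<^sub>v x) $ i = (\<Sum>j\<in>{0..<n}. (if i = j then f j else 0) * x $ j)"
        using that x by (auto simp: mat_diag_def scalar_prod_def intro!: sum.cong)
      also have "\<dots> = (\<Sum>j\<in>{0..<n}. if i = j then f j * x $ j else 0)"
        by (intro sum.cong) auto
      finally show ?thesis using that by simp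
    qed
    have "norm2 (mat_diag n f *\<^sub>v x) = L2_set (\<lambda>i. f i * x $ i) {..<n}"
      using ix by (auto simp: norm2_L2_set mat_diag_def intro!: L2_set_cong)
    also have "\<dots> = L2_set (\<lambda>i. \<bar>f i * x $ i\<bar>) {..<n}"
      by (simp add: L2_set_def)
    also have "\<dots> \<le> L2_set (\<lambda>i. c * \<bar>x $ i\<bar>) {..<n}"
      using f by (intro L2_set_mono) (auto simp: abs_mult intro!: mult_right_mono)
    also have "\<dots> = c * L2_set (\<lambda>i. \<bar>x $ i\<bar>) {..<n}"
      using c by (simp add: L2_set_right_distrib)
    also have "\<dots> = c * norm2 x"
      using x by (simp add: norm2_L2_set L2_set_def)
    finally show "norm2 (mat_diag n f *\<^sub>v x) \<le> c * norm2 x" .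
  qed simp
  have "op_bounded n (1 * c * 1) (V * mat_diag n f * V\<^sup>T)"
    by (intro op_bounded_mult op_bounded_isometry D) (use V VtV VVt in auto)
  then show ?thesis by (simp add: spectral_mat_def)
qed

lemma spectral_diff: "F f - F h = F (\<lambda>i. f i - h i)"
proof -
  have "F f = F (\<lambda>i. f i - h i) + F h"
    unfolding spectral_add by simp
  also have "\<dots> - F h = F (\<lambda>i. f i - h i)"
    by (intro eq_matI) auto
  finally show ?thesis .
qed

end

section \<open>Perturbation of the wavelets\<close>

text \<open>\<open>l\<close> is an upper bound rather than the second eigenvalue itself, so that two
  graphs can share one value.\<close>

locale gapped_spectrum = orthogonal_mat +
  fixes f :: "nat \<Rightarrow> real" and l :: real
  assumes f0: "f 0 = 1" and f_bounds: "\<And>i. 0 < i \<Longrightarrow> i < n \<Longrightarrow> 0 \<le> f i \<and> f i \<le> l"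
    and l: "0 \<le> l" "l < 1"
begin

abbreviation "T \<equiv> F f"
text \<open>\<open>P\<close> and \<open>Q\<close> project onto the first column of \<open>V\<close>
  and onto its orthogonal complement; \<open>R\<close> is \<open>T\<close> with the top eigenvalue
  replaced by 0.\<close>

abbreviation "P \<equiv> F (\<lambda>i. if i = 0 then 1 else 0)"
abbreviation "Q \<equiv> F (\<lambda>i. if i = 0 then 0 else 1)"
abbreviation "R \<equiv> F (\<lambda>i. if i = 0 then 0 else f i)"

lemma op_bounded_T: "op_bounded n 1 T"
proof (rule op_bounded_spectral)
  show "\<bar>f i\<bar> \<le> 1" if "i < n" for i
    using f0 f_bounds[of i] l that by (cases "i = 0") auto
qed simp

lemma op_bounded_P: "op_bounded n 1 P"
  by (rule op_bounded_spectral) auto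

lemma op_bounded_R: "op_bounded n l R"
  using f_bounds l by (intro op_bounded_spectral) auto

lemma P_plus_Q: "P + Q = 1\<^sub>m n"
  unfolding spectral_add spectral_one[symmetric] by (rule spectral_cong) auto

lemma T_mult_P: "T * P = P"
  unfolding spectral_mult using f0 by (intro spectral_cong) auto

lemma T_eq: "T = P + R"
  unfolding spectral_add using f0 by (intro spectral_cong) auto

text \<open>At index 0 this reads 1 = 1 + 0^k, which needs a positive exponent; the wavelets only
  use powers of 2.\<close>

lemma T_pow: "0 < k \<Longrightarrow> T ^\<^sub>m k = P + R ^\<^sub>m k"
  unfolding spectral_pow spectral_add using f0 by (intro spectral_cong) auto

end

text \<open>
  A perturbed top eigenvector \<open>w\<close> satisfies \<open>(I - T) w = (T' - T) w\<close>, and \<open>I - T\<close> is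
  invertible with norm-\<open>1 / (1 - l)\<close> inverse on the complement of the unperturbed one.
\<close>
lemma op_bounded_Q_mult_P:
  assumes "gapped_spectrum n V f l" "gapped_spectrum n V' f' l"
    and D: "op_bounded n d (spectral_mat n V f - spectral_mat n V' f')"
  shows "op_bounded n (d / (1 - l)) (spectral_mat n V (\<lambda>i. if i = 0 then 0 else 1)
           * spectral_mat n V' (\<lambda>i. if i = 0 then 1 else 0))"
proof -
  interpret A: gapped_spectrum n V f l by fact
  interpret B: gapped_spectrum n V' f' l by fact
  \<comment> \<open>\<open>S\<close> inverts I - T on the range of \<open>Q\<close>; the value 0 at
    index 0 avoids the reciprocal of 1 - f 0 = 0.\<close>
  define S where "S = A.F (\<lambda>i. if i = 0 then 0 else 1 / (1 - f i))"
  have S: "S \<in> carrier_mat n n" by (simp add: S_def)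
  have "op_bounded n (1 / (1 - l)) S"
    unfolding S_def
  proof (rule A.op_bounded_spectral)
    fix i assume i: "i < n"
    show "\<bar>if i = 0 then 0 else 1 / (1 - f i)\<bar> \<le> 1 / (1 - l)"
      using A.f_bounds[of i] A.l i by (auto simp: frac_le)
  qed (use A.l in simp)
  moreover have "op_bounded n d (B.T - A.T)"
  proof -
    have "B.T - A.T = - (A.T - B.T)"
      by (intro eq_matI) auto
    then show ?thesis using op_bounded_uminus[OF D] by simp
  qed
  ultimately have "op_bounded n (1 / (1 - l) * (d * 1)) (S * ((B.T - A.T) * B.P))"
    by (intro op_bounded_mult B.op_bounded_P)
  moreover have "S * ((B.T - A.T) * B.P) = A.Q * B.P"
  proof -
    \<comment> \<open>\<open>B.T\<close> fixes the range of \<open>B.P\<close>, so there the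
      perturbation acts as I - T.\<close>
    have "(B.T - A.T) * B.P = B.P - A.T * B.P"
      using B.T_mult_P minus_mult_distrib_mat[of B.T n n A.T B.P n] by simp
    also have "\<dots> = (1\<^sub>m n - A.T) * B.P"
      using minus_mult_distrib_mat[of "1\<^sub>m n" n n A.T B.P n] left_mult_one_mat[of B.P n n] by simp
    also have "1\<^sub>m n - A.T = A.F (\<lambda>i. 1 - f i)"
      unfolding A.spectral_one[symmetric] A.spectral_diff ..
    also have "S * (A.F (\<lambda>i. 1 - f i) * B.P) = S * A.F (\<lambda>i. 1 - f i) * B.P"
      using assoc_mult_mat[of S n n "A.F (\<lambda>i. 1 - f i)" n B.P n] S by simp
    also have "S * A.F (\<lambda>i. 1 - f i) = A.Q"
      unfolding S_def A.spectral_mult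
    proof (rule A.spectral_cong)
      fix i assume "i < n"
      then show "(if i = 0 then 0 else 1 / (1 - f i)) * (1 - f i) = (if i = 0 then 0 else 1)"
        using A.f_bounds[of i] A.l by (cases "i = 0") auto
    qed
    finally show ?thesis .
  qed
  ultimately show ?thesis by simp
qed

text \<open>Inserting P' + Q' = I = P + Q gives P - P' = P Q' - Q P', as P P' cancels. Both products
  fall under \<open>op_bounded_Q_mult_P\<close>, the first after transposing and exchanging the
  roles of the matrices; hence the factor 2.\<close>

lemma op_bounded_P_diff:
  assumes "gapped_spectrum n V f l" "gapped_spectrum n V' f' l"
    and D: "op_bounded n d (spectral_mat n V f - spectral_mat n V' f')"
  shows "op_bounded n (2 * d / (1 - l)) (spectral_mat n V (\<lambda>i. if i = 0 then 1 else 0)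
           - spectral_mat n V' (\<lambda>i. if i = 0 then 1 else 0))"
proof -
  interpret A: gapped_spectrum n V f l by fact
  interpret B: gapped_spectrum n V' f' l by fact
  have "B.T - A.T = - (A.T - B.T)"
    by (intro eq_matI) auto
  then have D': "op_bounded n d (B.T - A.T)"
    using op_bounded_uminus[OF D] by simp
  have "op_bounded n (d / (1 - l)) ((B.Q * A.P)\<^sup>T)"
    by (intro op_bounded_transpose op_bounded_Q_mult_P[OF assms(2,1) D'])
  then have 1: "op_bounded n (d / (1 - l)) (A.P * B.Q)"
    using transpose_mult[of B.Q n n A.P n] by (simp add: A.spectral_transpose B.spectral_transpose)
  have 2: "op_bounded n (d / (1 - l)) (A.Q * B.P)"
    by (rule op_bounded_Q_mult_P[OF assms])
  have "A.P = A.P * (B.P + B.Q)"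
    unfolding B.P_plus_Q using right_mult_one_mat[of A.P n n] by simp
  also have "\<dots> = A.P * B.P + A.P * B.Q"
    by (rule mult_add_distrib_mat[of _ n n _ n]) simp_all
  finally have AP: "A.P = A.P * B.P + A.P * B.Q" .
  have "B.P = (A.P + A.Q) * B.P"
    unfolding A.P_plus_Q using left_mult_one_mat[of B.P n n] by simp
  also have "\<dots> = A.P * B.P + A.Q * B.P"
    by (rule add_mult_distrib_mat[of _ n n _ _ n]) simp_all
  finally have BP: "B.P = A.P * B.P + A.Q * B.P" .
  have cancel: "X + Y - (X + Z) = Y - Z"
    if "X \<in> carrier_mat n n" "Y \<in> carrier_mat n n" "Z \<in> carrier_mat n n" for X Y Z :: "real mat"
    using that by (intro eq_matI) auto
  have "A.P - B.P = (A.P * B.P + A.P * B.Q) - (A.P * B.P + A.Q * B.P)"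
    by (rule arg_cong2[of _ _ _ _ minus, OF AP BP])
  also have "\<dots> = A.P * B.Q - A.Q * B.P"
    by (intro cancel mult_carrier_mat[of _ n n _ n]) simp_all
  finally have "A.P - B.P = A.P * B.Q - A.Q * B.P" .
  then show ?thesis
    using op_bounded_diff[OF 1 2] by simp
qed

text \<open>The summands are distinct terms, at k = 2^j - 1, of the nonnegative series of (k + 1)
  l^k. The bound is the same for every finite \<open>A\<close>, hence independent of the number of
  scales.\<close>

lemma sum_dyadic_le:
  fixes l :: real
  assumes "0 \<le> l" "l < 1" "finite A"
  shows "(\<Sum>j\<in>A. real (2 ^ j) * l ^ (2 ^ j - 1)) \<le> 1 / (1 - l)\<^sup>2"
proof -
  define b where "b = (\<lambda>k. real (Suc k) * l ^ k)"
  have b: "b sums (1 / (1 - l)\<^sup>2)"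
    using geometric_deriv_sums[of l] assms by (simp add: b_def)
  have "(\<Sum>j\<in>A. real (2 ^ j) * l ^ (2 ^ j - 1)) = (\<Sum>j\<in>A. b (2 ^ j - 1))"
    by (simp add: b_def)
  also have "\<dots> = sum b ((\<lambda>j. 2 ^ j - 1) ` A)"
  proof (rule sum.reindex_cong[symmetric])
    show "inj_on (\<lambda>j. 2 ^ j - 1 :: nat) A"
    proof (rule inj_onI)
      fix i j :: nat assume "2 ^ i - 1 = (2 ^ j - 1 :: nat)"
      moreover have "0 < (2 ^ i :: nat)" "0 < (2 ^ j :: nat)" by simp_all
      ultimately have "(2 ^ i :: nat) = 2 ^ j" by linarith
      then show "i = j" by simp
    qed
  qed auto
  also have "\<dots> \<le> suminf b"
    using b assms by (intro sum_le_suminf) (auto simp: sums_iff b_def)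
  also have "\<dots> = 1 / (1 - l)\<^sup>2" using b by (simp add: sums_iff)
  finally show ?thesis .
qed

text \<open>The first two terms account for the differences of \<open>T\<close> and of
  \<open>P\<close>; the last is the factor of the \<open>R\<close> difference times three dyadic
  sums.\<close>

definition wavelet_const :: "real \<Rightarrow> real" where
  "wavelet_const l = 1 + 2 / (1 - l) + 3 * (1 + 2 / (1 - l)) / (1 - l)\<^sup>2"

lemma family_norm2_wavelet_diff_le:
  assumes n: "0 < n" and "gapped_spectrum n V f l" "gapped_spectrum n V' f' l"
    and D: "op_bounded n d (spectral_mat n V f - spectral_mat n V' f')"
  shows "family_norm2 n {0..J + 1}
      (\<lambda>j. wavelet J (spectral_mat n V f) j - wavelet J (spectral_mat n V' f') j)
    \<le> wavelet_const l * d" (is "family_norm2 n _ ?W \<le> _")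
    and "0 \<le> family_norm2 n {0..J + 1}
      (\<lambda>j. wavelet J (spectral_mat n V f) j - wavelet J (spectral_mat n V' f') j)"
proof -
  interpret A: gapped_spectrum n V f l by fact
  interpret B: gapped_spectrum n V' f' l by fact
  have d: "0 \<le> d" using D by (simp add: op_bounded_def)
  define p where "p = 2 * d / (1 - l)"
  have P: "op_bounded n p (A.P - B.P)"
    unfolding p_def by (rule op_bounded_P_diff[OF assms(2-4)])
  define \<kappa> where "\<kappa> = d + p"
  have \<kappa>: "0 \<le> \<kappa>" using d A.l by (simp add: \<kappa>_def p_def)
  have "A.R - B.R = (A.P + A.R - (B.P + B.R)) - (A.P - B.P)"
    by (intro eq_matI) auto
  then have R: "op_bounded n \<kappa> (A.R - B.R)"
    using op_bounded_diff[OF D P] by (simp add: A.T_eq[symmetric] B.T_eq[symmetric] \<kappa>_def)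
  \<comment> \<open>The factor that \<open>op_bounded_pow_diff\<close> puts on \<kappa> for the
    exponent 2^j, with k = 2^j - 1.\<close>
  define e where "e j = real (2 ^ j) * l ^ (2 ^ j - 1)" for j :: nat
  have pow: "op_bounded n (\<kappa> * e j) (A.R ^\<^sub>m (2 ^ j) - B.R ^\<^sub>m (2 ^ j))" for j
    using op_bounded_pow_diff[OF A.op_bounded_R B.op_bounded_R R, of "2 ^ j - 1"] by (simp add: e_def)
  have Rc: "A.R ^\<^sub>m k \<in> carrier_mat n n" "B.R ^\<^sub>m k \<in> carrier_mat n n" for k
    unfolding A.spectral_pow B.spectral_pow by simp_all
  note carr = carrier_matD[OF Rc(1)] carrier_matD[OF Rc(2)]
  \<comment> \<open>High-pass, band-pass and low-pass members; only the last retains a difference of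
    projections.\<close>
  define c where "c j = (if j = 0 then d else if j \<le> J then \<kappa> * e (j - 1) + \<kappa> * e j else p + \<kappa> * e J)" for j
  have W: "op_bounded n (c j) (?W j)" for j
  proof -
    consider "j = 0" | "0 < j" "j \<le> J" | "j > J" by linarith
    then show ?thesis
    proof cases
      case 1
      have "?W j = - (A.T - B.T)"
        by (intro eq_matI) (auto simp: 1 wavelet_def carr)
      then show ?thesis using op_bounded_uminus[OF D] by (simp add: c_def 1)
    next
      case 2
      \<comment> \<open>Both exponents are positive, so each power splits off its projection, and
        the projections cancel.\<close>
      have "?W j = (A.R ^\<^sub>m 2 ^ (j - 1) - B.R ^\<^sub>m 2 ^ (j - 1)) - (A.R ^\<^sub>m 2 ^ j - B.R ^\<^sub>m 2 ^ j)"
        using 2 by (intro eq_matI) (auto simp: wavelet_def A.T_pow B.T_pow carr simp del: pow_mat_dim_square)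
      then show ?thesis using op_bounded_diff[OF pow[of "j - 1"] pow[of j]] 2 by (simp add: c_def)
    next
      case 3
      then have "?W j = (A.P - B.P) + (A.R ^\<^sub>m 2 ^ J - B.R ^\<^sub>m 2 ^ J)"
        by (intro eq_matI) (auto simp: wavelet_def A.T_pow B.T_pow carr)
      then show ?thesis using op_bounded_add[OF P pow[of J]] 3 by (simp add: c_def)
    qed
  qed
  show "0 \<le> family_norm2 n {0..J + 1} ?W"
    using family_norm2_le_sum(1)[OF n W] .
  have "family_norm2 n {0..J + 1} ?W \<le> sum c {0..J + 1}"
    using family_norm2_le_sum(2)[OF n W] .
  also have "sum c {0..J + 1} = d + (\<Sum>j\<in>{1..J}. \<kappa> * e (j - 1) + \<kappa> * e j) + (p + \<kappa> * e J)"
  proof -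
    have "sum c {0..J + 1} = c 0 + sum c {1..J} + c (J + 1)"
      by (simp add: sum.atLeast_Suc_atMost)
    moreover have "sum c {1..J} = (\<Sum>j\<in>{1..J}. \<kappa> * e (j - 1) + \<kappa> * e j)"
      by (intro sum.cong) (auto simp: c_def)
    ultimately show ?thesis by (simp add: c_def)
  qed
  \<comment> \<open>Regrouped into three sums over distinct scales, each of which
    \<open>sum_dyadic_le\<close> bounds.\<close>
  also have "\<dots> = d + p + \<kappa> * ((\<Sum>j\<in>{1..J}. e (j - 1)) + sum e {1..J} + sum e {J})"
    by (simp add: sum.distrib sum_distrib_left algebra_simps)
  also have "(\<Sum>j\<in>{1..J}. e (j - 1)) = sum e {0..<J}"
    by (rule sum.reindex_bij_witness[of _ Suc "\<lambda>j. j - 1"]) auto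
  also have "d + p + \<kappa> * (sum e {0..<J} + sum e {1..J} + sum e {J}) \<le>
      d + p + \<kappa> * (1 / (1 - l)\<^sup>2 + 1 / (1 - l)\<^sup>2 + 1 / (1 - l)\<^sup>2)"
    unfolding e_def using \<kappa> A.l
    by (intro add_left_mono mult_left_mono add_mono sum_dyadic_le) auto
  also have "\<dots> = wavelet_const l * d"
    by (simp add: wavelet_const_def \<kappa>_def p_def algebra_simps)
  finally show "family_norm2 n {0..J + 1} ?W \<le> wavelet_const l * d" .
qed

section \<open>Spectrum of the normalized Laplacian\<close>

text \<open>\<open>connected\<close> means reachability in the symmetric closure; induction along a
  path there carries the equality, whichever way an arc is traversed.\<close>

lemma weighted_connected_graph_const:
  assumes G: "weighted_connected_graph n G W"
    and y: "\<And>i j. (i, j) \<in> parcs G \<Longrightarrow> y i = y j"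
    and "i < n" "k < n"
  shows "y i = y k"
proof -
  have "i \<rightarrow>\<^sup>*\<^bsub>with_proj (mk_symmetric (with_proj G))\<^esub> k"
    using assms unfolding weighted_connected_graph_def connected_def strongly_connected_def
    by auto
  then show ?thesis
    unfolding reachable_def
  proof (induction rule: rtrancl_on_induct)
    case (step u v)
    from step(2) have "(u, v) \<in> parcs G \<or> (v, u) \<in> parcs G"
      by (auto simp: mk_symmetric_def)
    then have "y u = y v" using y by metis
    then show ?case using step by simp
  qed simp
qed

text \<open>The open coefficient \<open>s\<close> treats two forms at once: -1 gives the Dirichlet
  energy, 1 its signless counterpart. By symmetry of \<open>a\<close> both squares yield the same
  degree-weighted sum.\<close>

lemma sum_symmetric_form:
  fixes a :: "nat \<Rightarrow> nat \<Rightarrow> real"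
  assumes sym: "\<And>i j. i < n \<Longrightarrow> j < n \<Longrightarrow> a i j = a j i"
    and d: "\<And>i. i < n \<Longrightarrow> d i = (\<Sum>j<n. a i j)"
  shows "(\<Sum>i<n. \<Sum>j<n. a i j * (y i + s * y j)\<^sup>2) =
    (1 + s\<^sup>2) * (\<Sum>i<n. d i * (y i)\<^sup>2) + 2 * s * (\<Sum>i<n. y i * (\<Sum>j<n. a i j * y j))"
proof -
  have dy: "(\<Sum>i<n. \<Sum>j<n. a i j * (y i)\<^sup>2) = (\<Sum>i<n. d i * (y i)\<^sup>2)"
    by (simp add: d sum_distrib_right)
  have "(\<Sum>i<n. \<Sum>j<n. a i j * (y j)\<^sup>2) = (\<Sum>j<n. \<Sum>i<n. a i j * (y j)\<^sup>2)"
    by (rule sum.swap)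
  also have "\<dots> = (\<Sum>j<n. \<Sum>i<n. a j i * (y j)\<^sup>2)"
    by (intro sum.cong) (auto simp: sym)
  finally have dy': "(\<Sum>i<n. \<Sum>j<n. a i j * (y j)\<^sup>2) = (\<Sum>i<n. d i * (y i)\<^sup>2)"
    using dy by simp
  have "a i j * (y i + s * y j)\<^sup>2 =
      a i j * (y i)\<^sup>2 + s\<^sup>2 * (a i j * (y j)\<^sup>2) + 2 * s * (y i * (a i j * y j))" for i j
    by (simp add: power2_eq_square algebra_simps)
  then show ?thesis
    using dy dy' by (simp add: sum.distrib sum_distrib_left[symmetric] distrib_right)
qed

section \<open>Eigenvalues and eigenvectors of one connected graph\<close>

locale weighted_graph_spectrum =
  fixes n :: nat and G :: "nat pair_pre_digraph" and W :: "(nat \<times> nat) weight_fun"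
    and \<omega> :: "nat \<Rightarrow> real" and V :: "real mat"
  assumes n: "2 \<le> n" and G: "weighted_connected_graph n G W"
    and basis: "laplacian_eigenbasis n G W \<omega> V"
begin

definition "a i j = adj_mat n G W $$ (i, j)"
definition "d i = deg_vec n G W $ i"

lemma a_eq: "i < n \<Longrightarrow> j < n \<Longrightarrow> a i j = (if (i, j) \<in> parcs G then W (i, j) else 0)"
  by (simp add: a_def adj_mat_def)

lemma d_eq: "i < n \<Longrightarrow> d i = (\<Sum>j<n. a i j)"
  by (simp add: d_def deg_vec_def a_def)

lemma parcs_sym: "(i, j) \<in> parcs G \<longleftrightarrow> (j, i) \<in> parcs G"
proof -
  interpret pair_pseudo_graph G using G by (simp add: weighted_connected_graph_def)
  show ?thesis using arcs_symmetric by blast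
qed

lemma parcs_less: "(i, j) \<in> parcs G \<Longrightarrow> i < n \<and> j < n"
proof -
  interpret pair_pseudo_graph G using G by (simp add: weighted_connected_graph_def)
  have "pverts G = {0..<n}" using G by (simp add: weighted_connected_graph_def)
  then show "(i, j) \<in> parcs G \<Longrightarrow> i < n \<and> j < n"
    using in_arcsD1 in_arcsD2 by fastforce
qed

lemma a_sym: "i < n \<Longrightarrow> j < n \<Longrightarrow> a i j = a j i"
  using G parcs_sym[of i j] by (auto simp: a_eq weighted_connected_graph_def)

lemma a_pos: "(i, j) \<in> parcs G \<Longrightarrow> 0 < a i j"
  using G parcs_less[of i j] by (simp add: a_eq weighted_connected_graph_def)

lemma a_nonneg: "i < n \<Longrightarrow> j < n \<Longrightarrow> 0 \<le> a i j"
  using a_pos[of i j] by (cases "(i, j) \<in> parcs G") (auto simp: a_eq)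

text \<open>Without an arc at \<open>i\<close>, the indicator of \<open>i\<close> would be constant
  along arcs, hence constant by connectivity, although \<open>2 \<le> n\<close> supplies another
  vertex.\<close>

lemma d_pos:
  assumes i: "i < n"
  shows "0 < d i"
proof -
  obtain k where k: "k < n" "k \<noteq> i"
    using n that[of "if i = 0 then 1 else 0"] by auto
  have "\<exists>j. (i, j) \<in> parcs G"
  proof (rule ccontr)
    assume none: "\<nexists>j. (i, j) \<in> parcs G"
    have "(i = i) = (k = i)"
      by (rule weighted_connected_graph_const[OF G _ i k(1), of "\<lambda>j. j = i"])
        (use none parcs_sym in blast)
    then show False using k by simp
  qed
  then obtain j where j: "(i, j) \<in> parcs G" ..
  then have "0 < a i j" "j < n" using a_pos parcs_less by auto
  then show ?thesis
    unfolding d_eq[OF i] using i a_nonneg by (intro sum_pos2[of _ j]) auto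
qed

lemma V_carrier: "V \<in> carrier_mat n n" and V_orthogonal: "V\<^sup>T * V = 1\<^sub>m n"
  using basis by (auto simp: laplacian_eigenbasis_def)

lemma laplacian_entry:
  assumes "i < n" "j < n"
  shows "normalized_laplacian n G W $$ (i, j) =
    (if i = j then 1 else 0) - a i j / (sqrt (d i) * sqrt (d j))"
proof -
  have A: "adj_mat n G W \<in> carrier_mat n n" by (simp add: adj_mat_def)
  show ?thesis
    unfolding normalized_laplacian_def Let_def mat_diag_mult_left[OF A]
    by (subst mat_diag_mult_right[of _ n n]) (use assms in \<open>auto simp: a_def d_def\<close>)
qed

text \<open>The entries of \<open>D\<^sup>-\<^sup>1\<^sup>/\<^sup>2 v\<^sub>k\<close>, an eigenvector of the random-walk Laplacian \<open>I - D\<^sup>-\<^sup>1 A\<close>.\<close>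
definition "y k i = V $$ (i, k) / sqrt (d i)"

text \<open>Scaling row \<open>i\<close> of the eigenvalue equation by \<open>sqrt (d i)\<close>
  clears the square roots and leaves the generalised problem (D - A) y = \<omega> D y.\<close>

lemma eigen_eq:
  assumes i: "i < n" and k: "k < n"
  shows "d i * y k i - (\<Sum>j<n. a i j * y k j) = \<omega> k * (d i * y k i)"
proof -
  have N: "normalized_laplacian n G W \<in> carrier_mat n n"
    unfolding normalized_laplacian_def Let_def
    by (intro minus_carrier_mat mult_carrier_mat[of _ n n _ n] mat_diag_dim) (simp add: adj_mat_def)
  have "normalized_laplacian n G W *\<^sub>v col V k = \<omega> k \<cdot>\<^sub>v col V k"
    using basis k by (auto simp: laplacian_eigenbasis_def eigenvector_def)
  then have "(normalized_laplacian n G W *\<^sub>v col V k) $ i = (\<omega> k \<cdot>\<^sub>v col V k) $ i"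
    by simp
  moreover have "(normalized_laplacian n G W *\<^sub>v col V k) $ i =
      (\<Sum>j<n. normalized_laplacian n G W $$ (i, j) * V $$ (j, k))"
    using N V_carrier i k by (auto simp: scalar_prod_def atLeast0LessThan intro!: sum.cong)
  moreover have "\<dots> = (\<Sum>j<n. (if i = j then V $$ (j, k) else 0) - a i j * y k j / sqrt (d i))"
    using i by (intro sum.cong) (auto simp: laplacian_entry y_def field_simps)
  moreover have "\<dots> = V $$ (i, k) - (\<Sum>j<n. a i j * y k j) / sqrt (d i)"
    using i by (simp add: sum_subtractf sum_divide_distrib)
  ultimately have eq: "V $$ (i, k) - (\<Sum>j<n. a i j * y k j) / sqrt (d i) = \<omega> k * V $$ (i, k)"
    using V_carrier i k by simp
  define q where "q = sqrt (d i)"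
  have q: "q \<noteq> 0" "d i = q * q" and V_eq: "V $$ (i, k) = q * y k i"
    using d_pos[OF i] by (simp_all add: q_def y_def)
  have "d i * y k i - (\<Sum>j<n. a i j * y k j) = q * (q * y k i - (\<Sum>j<n. a i j * y k j) / q)"
    using q by (simp add: right_diff_distrib)
  also have "\<dots> = q * (\<omega> k * (q * y k i))"
    using eq by (simp only: V_eq q_def[symmetric])
  also have "\<dots> = \<omega> k * (d i * y k i)"
    by (simp add: q(2))
  finally show ?thesis .
qed

lemma column_scalar_prod:
  assumes "k < n" "m < n"
  shows "(\<Sum>i<n. d i * (y k i * y m i)) = (if k = m then 1 else 0)"
proof -
  have "(V\<^sup>T * V) $$ (k, m) = (\<Sum>i<n. V $$ (i, k) * V $$ (i, m))"
    using V_carrier assms by (auto simp: scalar_prod_def atLeast0LessThan intro!: sum.cong)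
  moreover have "\<dots> = (\<Sum>i<n. d i * (y k i * y m i))"
  proof (rule sum.cong)
    fix i assume "i \<in> {..<n}"
    then have "0 < d i" by (simp add: d_pos)
    then show "V $$ (i, k) * V $$ (i, m) = d i * (y k i * y m i)"
      by (simp add: y_def field_simps)
  qed simp
  ultimately show ?thesis using V_orthogonal assms by simp
qed

text \<open>For \<open>y k\<close>, of degree-weighted norm 1, the eigenvalue equation gives <y, A
  y> = 1 - \<omega>. The form equals 2 \<omega> at s = -1 and 2 (2 - \<omega>) at s = 1, whence the
  eigenvalue bounds.\<close>

lemma dirichlet_form:
  assumes k: "k < n"
  shows "(\<Sum>i<n. \<Sum>j<n. a i j * (y k i + s * y k j)\<^sup>2) = 1 + s\<^sup>2 + 2 * s * (1 - \<omega> k)"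
proof -
  have norm: "(\<Sum>i<n. d i * (y k i)\<^sup>2) = 1"
    using column_scalar_prod[OF k k] by (simp add: power2_eq_square)
  have "(\<Sum>i<n. y k i * (\<Sum>j<n. a i j * y k j)) = (\<Sum>i<n. (1 - \<omega> k) * (d i * (y k i)\<^sup>2))"
  proof (rule sum.cong)
    fix i assume "i \<in> {..<n}"
    then have *: "(\<Sum>j<n. a i j * y k j) = d i * y k i - \<omega> k * (d i * y k i)"
      using eigen_eq[of i k] k by simp
    show "y k i * (\<Sum>j<n. a i j * y k j) = (1 - \<omega> k) * (d i * (y k i)\<^sup>2)"
      unfolding * by (simp add: power2_eq_square algebra_simps)
  qed simp
  also have "\<dots> = 1 - \<omega> k" using norm by (simp add: sum_distrib_left[symmetric])
  finally show ?thesis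
    using sum_symmetric_form[of n a d "y k" s] norm a_sym d_eq by simp
qed

lemma eigenvalue_bounds:
  assumes k: "k < n"
  shows "0 \<le> \<omega> k" "\<omega> k \<le> 2"
proof -
  have "0 \<le> (\<Sum>i<n. \<Sum>j<n. a i j * (y k i + s * y k j)\<^sup>2)" for s
    by (intro sum_nonneg mult_nonneg_nonneg a_nonneg) auto
  then have nonneg: "0 \<le> 1 + s\<^sup>2 + 2 * s * (1 - \<omega> k)" for s
    unfolding dirichlet_form[OF k] .
  show "0 \<le> \<omega> k" "\<omega> k \<le> 2" using nonneg[of "-1"] nonneg[of 1] by simp_all
qed

text \<open>The Dirichlet energy vanishes, hence so does each of its nonnegative terms; positive
  weights force equal values along arcs.\<close>

lemma y_const_if_eigenvalue_0:
  assumes k: "k < n" and 0: "\<omega> k = 0" and i: "i < n" "j < n"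
  shows "y k i = y k j"
proof (rule weighted_connected_graph_const[OF G _ i])
  fix u v assume uv: "(u, v) \<in> parcs G"
  have "(\<Sum>i<n. \<Sum>j<n. a i j * (y k i + (- 1) * y k j)\<^sup>2) = 0"
    unfolding dirichlet_form[OF k] 0 by simp
  then have "(\<Sum>j<n. a u j * (y k u + (- 1) * y k j)\<^sup>2) = 0"
    using parcs_less[OF uv] a_nonneg by (subst (asm) sum_nonneg_eq_0_iff) (auto intro!: sum_nonneg)
  then have "a u v * (y k u + (- 1) * y k v)\<^sup>2 = 0"
    using parcs_less[OF uv] a_nonneg by (subst (asm) sum_nonneg_eq_0_iff) auto
  then show "y k u = y k v" using a_pos[OF uv] by simp
qed

text \<open>The prescribed first column is a multiple of d^(1/2), so dividing by d^(1/2) leaves a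
  constant, nonzero because the column has norm 1.\<close>

lemma y_0_const:
  "\<exists>c. c \<noteq> 0 \<and> (\<forall>i<n. y 0 i = c)"
proof -
  define c where "c = 1 / norm2 (map_vec sqrt (deg_vec n G W))"
  have y0: "y 0 i = c" if i: "i < n" for i
  proof -
    have "col V 0 = c \<cdot>\<^sub>v map_vec sqrt (deg_vec n G W)"
      using basis by (simp add: laplacian_eigenbasis_def Let_def c_def)
    then have "col V 0 $ i = (c \<cdot>\<^sub>v map_vec sqrt (deg_vec n G W)) $ i" by simp
    moreover have "dim_vec (deg_vec n G W) = n" by (simp add: deg_vec_def)
    ultimately have "V $$ (i, 0) = c * sqrt (d i)"
      using i n V_carrier by (simp add: d_def)
    then show ?thesis using d_pos[OF i] by (simp add: y_def)
  qed
  moreover have "c \<noteq> 0"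
  proof
    assume "c = 0"
    then have "(\<Sum>i<n. d i * (y 0 i * y 0 i)) = 0" using y0 by simp
    then show False using column_scalar_prod[of 0 0] n by simp
  qed
  ultimately show ?thesis by blast
qed

text \<open>Row sums of the adjacency matrix are the degrees, so D - A annihilates the constant
  vector \<open>y 0\<close>.\<close>

lemma eigenvalue_0: "\<omega> 0 = 0"
proof -
  obtain c where c: "\<And>i. i < n \<Longrightarrow> y 0 i = c" "c \<noteq> 0" using y_0_const by blast
  have n0: "0 < n" using n by simp
  have "(\<Sum>j<n. a 0 j * y 0 j) = d 0 * c"
    using c n0 by (simp add: d_eq sum_distrib_right)
  then have "\<omega> 0 * (d 0 * c) = 0"
    using eigen_eq[OF n0 n0] c n0 by simp
  then show ?thesis using c d_pos[OF n0] by simp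
qed

text \<open>Otherwise \<open>y 0\<close> and \<open>y 1\<close> would both be constant, hence
  proportional, against their orthogonality. Connectivity thus yields the spectral gap.\<close>

lemma eigenvalue_1_pos: "0 < \<omega> 1"
proof (rule ccontr)
  assume "\<not> 0 < \<omega> 1"
  then have w1: "\<omega> 1 = 0" using eigenvalue_bounds[of 1] n by simp
  obtain c where c: "\<And>i. i < n \<Longrightarrow> y 0 i = c" "c \<noteq> 0" using y_0_const by blast
  define e where "e = y 1 0"
  have y1: "y 1 i = e" if "i < n" for i
    unfolding e_def using y_const_if_eigenvalue_0[OF _ w1 that, of 0] n by simp
  have "(\<Sum>i<n. d i * (y 1 i * y 1 i)) = (\<Sum>i<n. d i * (y 0 i * y 1 i)) * (e / c)"
    unfolding sum_distrib_right using y1 c by (intro sum.cong) auto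
  then show False
    using column_scalar_prod[of 1 1] column_scalar_prod[of 0 1] n by simp
qed

lemma gapped_spectrum_diffusion:
  assumes g: "spectral_filter g" and l: "g (\<omega> 1) \<le> l" "l < 1"
  shows "gapped_spectrum n V (\<lambda>i. g (\<omega> i)) l"
proof
  have bounds: "0 \<le> g (\<omega> k)" if "k < n" for k
    using g eigenvalue_bounds[OF that] by (auto simp: spectral_filter_def Pi_iff)
  show "0 \<le> g (\<omega> i) \<and> g (\<omega> i) \<le> l" if i: "0 < i" "i < n" for i
  proof -
    have "\<omega> 1 \<le> \<omega> i"
      using basis i by (auto simp: laplacian_eigenbasis_def intro!: mono_onD[of "{..<n}" \<omega>])
    then have "g (\<omega> i) \<le> g (\<omega> 1)"
      using g eigenvalue_bounds[of 1] eigenvalue_bounds[of i] i n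
      by (auto simp: spectral_filter_def monotone_on_def)
    then show ?thesis using bounds i l by simp
  qed
  show "0 \<le> l" using bounds[of 1] n l by simp
  show "g (\<omega> 0) = 1" using g by (simp add: eigenvalue_0 spectral_filter_def)
qed (use V_carrier V_orthogonal l in auto)

lemma filter_eigenvalue_1_less: "spectral_filter g \<Longrightarrow> g (\<omega> 1) < 1"
  using eigenvalue_1_pos eigenvalue_bounds[of 1] n by (auto simp: spectral_filter_def)

end

section \<open>One constant for all pairs of graphs and all numbers of scales\<close>

theorem theorem4p2:
  shows "\<exists>C :: real \<Rightarrow> real.
    \<forall>(n :: nat) (g :: real \<Rightarrow> real) (J :: nat)
      (G :: nat pair_pre_digraph) (W :: (nat \<times> nat) weight_fun) (\<omega> :: nat \<Rightarrow> real) (V :: real mat)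
      (G' :: nat pair_pre_digraph) (W' :: (nat \<times> nat) weight_fun) (\<omega>' :: nat \<Rightarrow> real) (V' :: real mat).
      2 \<le> n \<longrightarrow> spectral_filter g \<longrightarrow>
      weighted_connected_graph n G W \<longrightarrow> laplacian_eigenbasis n G W \<omega> V \<longrightarrow>
      weighted_connected_graph n G' W' \<longrightarrow> laplacian_eigenbasis n G' W' \<omega>' V' \<longrightarrow>
      (let T = diffusion_mat n g \<omega> V;
           T' = diffusion_mat n g \<omega>' V';
           l1_star = max (g (\<omega> 1)) (g (\<omega>' 1))
       in (family_norm2 n {0..J + 1} (\<lambda>j. wavelet J T j - wavelet J T' j))\<^sup>2
            \<le> C l1_star * opnorm2 n (T - T'))"
\<comment> \<open>The witness is fixed before \<open>n\<close>, \<open>g\<close>, \<open>J\<close>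
  and the graphs. Its square comes from squaring the linear estimate, its factor 2 from \<delta>
  \<le> 2.\<close>
proof (rule exI[of _ "\<lambda>l. 2 * (wavelet_const l)\<^sup>2"], intro allI impI)
  fix n J :: nat and g :: "real \<Rightarrow> real" and G G' :: "nat pair_pre_digraph"
    and W W' :: "(nat \<times> nat) weight_fun" and \<omega> \<omega>' :: "nat \<Rightarrow> real" and V V' :: "real mat"
  assume n: "2 \<le> n" and g: "spectral_filter g"
    and G: "weighted_connected_graph n G W" "laplacian_eigenbasis n G W \<omega> V"
    and G': "weighted_connected_graph n G' W'" "laplacian_eigenbasis n G' W' \<omega>' V'"
  interpret A: weighted_graph_spectrum n G W \<omega> V using n G by unfold_locales
  interpret B: weighted_graph_spectrum n G' W' \<omega>' V' using n G' by unfold_locales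
  define l where "l = max (g (\<omega> 1)) (g (\<omega>' 1))"
  have "l < 1" using A.filter_eigenvalue_1_less B.filter_eigenvalue_1_less g by (simp add: l_def)
  then have gap: "gapped_spectrum n V (\<lambda>i. g (\<omega> i)) l" "gapped_spectrum n V' (\<lambda>i. g (\<omega>' i)) l"
    using A.gapped_spectrum_diffusion[OF g] B.gapped_spectrum_diffusion[OF g] by (simp_all add: l_def)
  define T where "T = diffusion_mat n g \<omega> V"
  define T' where "T' = diffusion_mat n g \<omega>' V'"
  have T: "T = spectral_mat n V (\<lambda>i. g (\<omega> i))" "T' = spectral_mat n V' (\<lambda>i. g (\<omega>' i))"
    by (simp_all add: T_def T'_def diffusion_mat_def spectral_mat_def)
  have n0: "0 < n" using n by simp
  \<comment> \<open>Each diffusion matrix has norm at most 1; this makes the supremum finite and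
    gives \<delta> \<le> 2.\<close>
  have "op_bounded n (1 + 1) (T - T')"
    unfolding T by (intro op_bounded_diff gapped_spectrum.op_bounded_T[OF gap(1)]
        gapped_spectrum.op_bounded_T[OF gap(2)])
  note op = op_bounded_opnorm2[OF n0 this]
  define \<delta> where "\<delta> = opnorm2 n (T - T')"
  have \<delta>: "0 \<le> \<delta>" "\<delta> \<le> 2" using op by (auto simp: \<delta>_def op_bounded_def)
  note family = family_norm2_wavelet_diff_le[OF n0 gap op(1)[unfolded T], folded T, of J, folded \<delta>_def]
  have "(family_norm2 n {0..J + 1} (\<lambda>j. wavelet J T j - wavelet J T' j))\<^sup>2 \<le> (wavelet_const l * \<delta>)\<^sup>2"
    using family by (rule power_mono)
  also have "\<dots> = (wavelet_const l)\<^sup>2 * (\<delta> * \<delta>)"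
    by (simp add: power2_eq_square)
  also have "\<dots> \<le> (wavelet_const l)\<^sup>2 * (2 * \<delta>)"
    using \<delta> by (intro mult_left_mono mult_right_mono) auto
  finally have "(family_norm2 n {0..J + 1} (\<lambda>j. wavelet J T j - wavelet J T' j))\<^sup>2
      \<le> 2 * (wavelet_const l)\<^sup>2 * opnorm2 n (T - T')"
    by (simp add: \<delta>_def)
  then show "let T = diffusion_mat n g \<omega> V;
           T' = diffusion_mat n g \<omega>' V';
           l1_star = max (g (\<omega> 1)) (g (\<omega>' 1))
       in (family_norm2 n {0..J + 1} (\<lambda>j. wavelet J T j - wavelet J T' j))\<^sup>2
            \<le> 2 * (wavelet_const l1_star)\<^sup>2 * opnorm2 n (T - T')"
    by (simp add: Let_def T_def T'_def l_def)
qed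

end
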